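(* If $n$ is a positive integer and $r$ and $s$ are any integers, then \[ 5\sum_{k = 0}^{\lfloor n/2 \rfloor } \binom n{2k}F_{3k + r} F_{3k + s} = 2^{n - 1} \big( L_{2n + r + s} + ( - 1)^n L_{n + r + s} \big) - ( - 1)^s \sqrt{2^n} \cos \Big(\frac{n\pi}{4}\Big) L_{r - s}, \] \[ \sum_{k = 0}^{\lfloor n/2 \rfloor } \binom n{2k}L_{3k + r} F_{3k + s} = 2^{n - 1} \bigl( F_{2n + r + s} + ( - 1)^n F_{n + r + s} \bigr) - ( - 1)^s \sqrt{2^n} \cos\Big(\frac{n\pi}{4}\Big)F_{r - s}, \] \[ \sum_{k = 0}^{\lfloor n/2 \rfloor } \binom n{2k}L_{3k + r} L_{3k + s} = 2^{n - 1} \bigl( L_{2n + r + s} + ( - 1)^n L_{n + r + s} \bigr) + ( - 1)^s \sqrt{2^n} \cos\Big(\frac{n\pi}{4}\Big)L_{r - s}. \]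
   Context: The Fibonacci numbers $F_j$ and Lucas numbers $L_j$ are defined for all integers $j$ by $F_0=0$, $F_1=1$, $L_0=2$, $L_1=1$, $F_j=F_{j-1}+F_{j-2}$, $L_j=L_{j-1}+L_{j-2}$, with $F_{-j}=(-1)^{j-1}F_j$ and $L_{-j}=(-1)^jL_j$. *)

theory Defs
  imports Complex_Main "HOL-Number_Theory.Fib"
begin

fun lucas_nat :: "nat \<Rightarrow> nat" where
  "lucas_nat 0 = 2"
| "lucas_nat (Suc 0) = 1"
| "lucas_nat (Suc (Suc n)) = lucas_nat (Suc n) + lucas_nat n"

text \<open>
  Extension to negative indices by \<open>F\<^sub>-\<^sub>j = (-1)\<^sup>j\<^sup>-\<^sup>1 F\<^sub>j\<close> and \<open>L\<^sub>-\<^sub>j = (-1)\<^sup>j L\<^sub>j\<close>.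
  In the negative branches \<open>nat (- j) \<ge> 1\<close>, so the subtraction does not truncate.
\<close>

definition Fibonacci :: "int \<Rightarrow> int" where
  "Fibonacci j = (if 0 \<le> j then int (fib (nat j))
                  else (- 1) ^ (nat (- j) - 1) * int (fib (nat (- j))))"

definition Lucas :: "int \<Rightarrow> int" where
  "Lucas j = (if 0 \<le> j then int (lucas_nat (nat j))
              else (- 1) ^ nat (- j) * int (lucas_nat (nat (- j))))"

lemma Fibonacci_0: "Fibonacci 0 = 0" and Fibonacci_1: "Fibonacci 1 = 1"
  by (simp_all add: Fibonacci_def)

lemma Lucas_0: "Lucas 0 = 2" and Lucas_1: "Lucas 1 = 1"
  by (simp_all add: Lucas_def)

lemma int_index_cases:
  fixes j :: int
  obtains m where "j = int m + 2" | "j = 1" | "j = 0" | m where "j = - int (Suc m)"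
proof -
  consider "j \<ge> 2" | "j = 1" | "j = 0" | "j \<le> -1" by linarith
  then show thesis
  proof cases
    case 1
    then show thesis using that(1)[of "nat (j - 2)"] by simp
  next
    case 4
    then show thesis using that(4)[of "nat (- j - 1)"] by simp
  qed (use that in auto)
qed

lemma Fibonacci_rec: "Fibonacci j = Fibonacci (j - 1) + Fibonacci (j - 2)"
proof (cases j rule: int_index_cases)
  case (1 m)
  then have "nat j = Suc (Suc m)" "nat (j - 1) = Suc m" "nat (j - 2) = m" by auto
  with 1 show ?thesis by (simp add: Fibonacci_def)
next
  case (4 m)
  then have "nat (- j) = Suc m" "nat (- (j - 1)) = Suc (Suc m)"
    "nat (- (j - 2)) = Suc (Suc (Suc m))" by auto
  with 4 show ?thesis by (simp add: Fibonacci_def algebra_simps)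
qed (simp_all add: Fibonacci_def numeral_eq_Suc)

lemma Lucas_rec: "Lucas j = Lucas (j - 1) + Lucas (j - 2)"
proof (cases j rule: int_index_cases)
  case (1 m)
  then have "nat j = Suc (Suc m)" "nat (j - 1) = Suc m" "nat (j - 2) = m" by auto
  with 1 show ?thesis by (simp add: Lucas_def)
next
  case (4 m)
  then have "nat (- j) = Suc m" "nat (- (j - 1)) = Suc (Suc m)"
    "nat (- (j - 2)) = Suc (Suc (Suc m))" by auto
  with 4 show ?thesis by (simp add: Lucas_def algebra_simps)
qed (simp_all add: Lucas_def numeral_eq_Suc)

end

theory Submission imports Defs begin

text \<open>
  By the Binet formulas, each product of two terms with indices \<open>3k + r\<close> and \<open>3k + s\<close> splits into a
  term with index \<open>6k + r + s\<close> and \<open>(-1)\<^sup>k\<close> times a term that does not depend on \<open>k\<close>.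
  The even part of the binomial expansion of \<open>(1 + y)\<^sup>n\<close> then settles everything: for a root \<open>x\<close> of
  \<open>x\<^sup>2 = x + 1\<close> one has \<open>1 + x\<^sup>3 = 2x\<^sup>2\<close> and \<open>1 - x\<^sup>3 = -2x\<close>, which handles \<open>y = x\<^sup>3\<close>,
  while \<open>y = \<i>\<close> produces the real part of \<open>(1 + \<i>)\<^sup>n\<close>.
\<close>

section \<open>Even part of the binomial expansion\<close>

text \<open>The odd powers cancel between the two expansions and the even ones double. Keeping the
  factor 2 on the left avoids division, so the identity holds in any commutative ring and serves for
  both real and complex \<open>x\<close>.\<close>

lemma sum_even_binomial:
  fixes x :: "'a :: comm_ring_1"
  shows "2 * (\<Sum>k = 0..n div 2. of_nat (n choose (2 * k)) * x ^ (2 * k)) = (1 + x) ^ n + (1 - x) ^ n"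
proof -
  have "(1 + x) ^ n + (1 - x) ^ n = (x + 1) ^ n + (- x + 1) ^ n"
    by (simp add: add.commute)
  also have "\<dots> = (\<Sum>k\<le>n. of_nat (n choose k) * x ^ k + of_nat (n choose k) * (- x) ^ k)"
    by (simp only: binomial_ring sum.distrib power_one mult_1_right)
  also have "\<dots> = (\<Sum>k | k \<le> n \<and> even k. 2 * (of_nat (n choose k) * x ^ k))"
    by (intro sum.mono_neutral_cong_right) auto
  also have "\<dots> = (\<Sum>k = 0..n div 2. 2 * (of_nat (n choose (2 * k)) * x ^ (2 * k)))"
    by (rule sum.reindex_bij_witness[of _ "\<lambda>k. 2 * k" "\<lambda>k. k div 2"]) auto
  finally show ?thesis
    by (simp add: sum_distrib_left)
qed

lemma sum_even_binomial_alternating: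
  "(\<Sum>k = 0..n div 2. real (n choose (2 * k)) * (- 1) ^ k) = sqrt (2 ^ n) * cos (real n * pi / 4)"
proof -
  let ?S = "\<Sum>k = 0..n div 2. real (n choose (2 * k)) * (- 1) ^ k"
  \<comment> \<open>Modulus and argument of 1 + \<i> are the source of \<open>sqrt (2 ^ n)\<close>
    and, by De Moivre, of the cosine.\<close>
  have polar: "1 + \<i> = complex_of_real (sqrt 2) * cis (pi / 4)"
    by (simp add: complex_eq_iff cos_45 sin_45)
  have "2 * complex_of_real ?S = (1 + \<i>) ^ n + (1 - \<i>) ^ n"
    using sum_even_binomial[of n \<i>] by (simp add: power_mult)
  also have "(1 - \<i>) ^ n = cnj ((1 + \<i>) ^ n)"
    by simp
  also have "(1 + \<i>) ^ n + cnj ((1 + \<i>) ^ n) = complex_of_real (2 * Re ((1 + \<i>) ^ n))"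
    by (rule complex_add_cnj)
  also have "Re ((1 + \<i>) ^ n) = sqrt (2 ^ n) * cos (real n * pi / 4)"
    unfolding polar power_mult_distrib Complex.DeMoivre
    by (simp add: real_sqrt_power flip: of_real_power)
  finally have "complex_of_real (2 * ?S) = complex_of_real (2 * (sqrt (2 ^ n) * cos (real n * pi / 4)))"
    by simp
  then show ?thesis
    unfolding of_real_eq_iff by simp
qed

lemma sum_even_binomial_golden:
  fixes x :: real
  assumes x: "x\<^sup>2 = x + 1" and "n > 0"
  shows "(\<Sum>k = 0..n div 2. real (n choose (2 * k)) * x powi (6 * int k + t))
    = 2 ^ (n - 1) * (x powi (2 * int n + t) + (- 1) ^ n * x powi (int n + t))"
proof -
  have [simp]: "x \<noteq> 0"
    using x by auto
  have "x ^ 3 = x * x\<^sup>2"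
    by (simp add: power3_eq_cube power2_eq_square)
  also have "\<dots> = x\<^sup>2 + x"
    by (simp add: x algebra_simps flip: power2_eq_square)
  finally have x3: "1 + x ^ 3 = 2 * x\<^sup>2" "1 - x ^ 3 = (- 1) * 2 * x"
    using x by auto
  have shift: "x powi (2 * int n + t) = (x\<^sup>2) ^ n * x powi t" "x powi (int n + t) = x ^ n * x powi t"
    by (simp_all add: power_int_add power_int_mult)
  \<comment> \<open>The exponent 6k is 3 times 2k, so the sum is an even binomial sum in
    \<open>x ^ 3\<close>, with the constant factor \<open>x powi t\<close> pulled out.\<close>
  have "2 * (\<Sum>k = 0..n div 2. real (n choose (2 * k)) * x powi (6 * int k + t))
      = 2 * (\<Sum>k = 0..n div 2. real (n choose (2 * k)) * (x ^ 3) ^ (2 * k)) * x powi t"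
    by (simp add: sum_distrib_right power_int_add power_int_mult mult.assoc flip: power_mult)
  also have "\<dots> = ((2 * x\<^sup>2) ^ n + ((- 1) * 2 * x) ^ n) * x powi t"
    by (simp only: sum_even_binomial x3)
  also have "\<dots> = 2 ^ n * (x powi (2 * int n + t) + (- 1) ^ n * x powi (int n + t))"
    unfolding shift by (simp only: power_mult_distrib distrib_right distrib_left mult_ac)
  \<comment> \<open>Positivity of \<open>n\<close> allows halving \<open>2 ^ n\<close> to
    \<open>2 ^ (n - 1)\<close>; at \<open>n = 0\<close> the truncated subtraction would give a wrong
    factor.\<close>
  finally show ?thesis
    using \<open>n > 0\<close> by (cases n) auto
qed

section \<open>Two-sided recurrences and the Binet formulas\<close>

text \<open>The recurrence can be run in both directions, so two consecutive values fix the whole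
  sequence. This yields the Binet formulas at negative indices without a separate sign
  computation.\<close>

lemma fibonacci_recurrence_unique:
  fixes f g :: "int \<Rightarrow> 'a :: ab_group_add"
  assumes f: "\<And>j. f j = f (j - 1) + f (j - 2)" and g: "\<And>j. g j = g (j - 1) + g (j - 2)"
    and "f 0 = g 0" "f 1 = g 1"
  shows "f j = g j"
proof -
  \<comment> \<open>The recurrence has order two, so the induction carries a pair of neighbouring
    values.\<close>
  have "f j = g j \<and> f (j + 1) = g (j + 1)"
  proof (induction j rule: int_induct[of _ 0])
    case (step1 i)
    then show ?case
      using f[of "i + 2"] g[of "i + 2"] by (simp add: algebra_simps)
  next
    case (step2 i)
    have "f (i - 1) = f (i + 1) - f i" "g (i - 1) = g (i + 1) - g i"
      using f[of "i + 1"] g[of "i + 1"] by simp_all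
    with step2 show ?case
      by simp
  qed (use assms(3,4) in simp_all)
  then show ?thesis ..
qed

lemma golden_power_int_rec:
  fixes x :: real
  assumes "x\<^sup>2 = x + 1"
  shows "x powi j = x powi (j - 1) + x powi (j - 2)"
proof -
  have [simp]: "x \<noteq> 0"
    using assms by auto
  have "x powi j = x powi (j - 2) * x\<^sup>2" "x powi (j - 1) = x powi (j - 2) * x"
    using power_int_add[of x "j - 2" 2] power_int_add[of x "j - 2" 1] by simp_all
  then show ?thesis
    by (simp add: assms algebra_simps)
qed

definition golden :: real where
  "golden = (1 + sqrt 5) / 2"

definition golden_conj :: real where
  "golden_conj = (1 - sqrt 5) / 2"

lemma golden_square: "golden\<^sup>2 = golden + 1" "golden_conj\<^sup>2 = golden_conj + 1"
  by (simp_all add: golden_def golden_conj_def power2_eq_square field_simps)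

lemma golden_mult: "golden * golden_conj = - 1"
  by (simp add: golden_def golden_conj_def field_simps)

lemma golden_nonzero [simp]: "golden \<noteq> 0" "golden_conj \<noteq> 0"
  using golden_mult by auto

lemma Binet_Fibonacci:
  "real_of_int (Fibonacci j) = (golden powi j - golden_conj powi j) / sqrt 5"
proof (rule fibonacci_recurrence_unique[where j = j])
  show "real_of_int (Fibonacci j) = real_of_int (Fibonacci (j - 1)) + real_of_int (Fibonacci (j - 2))" for j
    by (metis Fibonacci_rec of_int_add)
  show "(golden powi j - golden_conj powi j) / sqrt 5
      = (golden powi (j - 1) - golden_conj powi (j - 1)) / sqrt 5
        + (golden powi (j - 2) - golden_conj powi (j - 2)) / sqrt 5" for j
    using golden_power_int_rec[OF golden_square(1), of j] golden_power_int_rec[OF golden_square(2), of j]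
    by (simp flip: add_divide_distrib)
qed (simp_all add: Fibonacci_0 Fibonacci_1 golden_def golden_conj_def field_simps)

lemma Binet_Lucas:
  "real_of_int (Lucas j) = golden powi j + golden_conj powi j"
proof (rule fibonacci_recurrence_unique[where j = j])
  show "real_of_int (Lucas j) = real_of_int (Lucas (j - 1)) + real_of_int (Lucas (j - 2))" for j
    by (metis Lucas_rec of_int_add)
  show "golden powi j + golden_conj powi j
      = (golden powi (j - 1) + golden_conj powi (j - 1)) + (golden powi (j - 2) + golden_conj powi (j - 2))" for j
    using golden_power_int_rec[OF golden_square(1), of j] golden_power_int_rec[OF golden_square(2), of j]
    by simp
qed (simp_all add: Lucas_0 Lucas_1 golden_def golden_conj_def field_simps)

section \<open>Products of two Fibonacci or Lucas numbers\<close>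

text \<open>Split off \<open>powi b\<close> from the first factor: since the two roots multiply to
  -1, the matched powers collapse to a sign and only exponent \<open>a - b\<close> remains. These
  cross terms become the part of each product that depends on the index difference.\<close>

lemma golden_mixed_product:
  "golden powi a * golden_conj powi b = (- 1) powi b * golden powi (a - b)"
  "golden_conj powi a * golden powi b = (- 1) powi b * golden_conj powi (a - b)"
proof -
  have "x powi a * y powi b = (x * y) powi b * x powi (a - b)" if "x \<noteq> 0" for x y :: real
    using that by (simp add: power_int_mult_distrib power_int_diff)
  from this[of golden golden_conj] this[of golden_conj golden]
  show "golden powi a * golden_conj powi b = (- 1) powi b * golden powi (a - b)"
    "golden_conj powi a * golden powi b = (- 1) powi b * golden_conj powi (a - b)"
    by (simp_all add: golden_mult mult.commute[of golden_conj golden])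
qed

lemma Fibonacci_mult_Fibonacci:
  "5 * (real_of_int (Fibonacci a) * real_of_int (Fibonacci b))
    = real_of_int (Lucas (a + b)) - (- 1) powi b * real_of_int (Lucas (a - b))"
proof -
  have "5 * (real_of_int (Fibonacci a) * real_of_int (Fibonacci b))
      = (golden powi a - golden_conj powi a) * (golden powi b - golden_conj powi b)"
    by (simp add: Binet_Fibonacci)
  also have "\<dots> = golden powi (a + b) + golden_conj powi (a + b)
      - golden powi a * golden_conj powi b - golden_conj powi a * golden powi b"
    by (simp add: power_int_add algebra_simps)
  finally show ?thesis
    unfolding golden_mixed_product Binet_Lucas by (simp add: algebra_simps)
qed

lemma Lucas_mult_Fibonacci:
  "real_of_int (Lucas a) * real_of_int (Fibonacci b)
    = real_of_int (Fibonacci (a + b)) - (- 1) powi b * real_of_int (Fibonacci (a - b))"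
proof -
  have "real_of_int (Lucas a) * real_of_int (Fibonacci b)
      = (golden powi a + golden_conj powi a) * (golden powi b - golden_conj powi b) / sqrt 5"
    by (simp add: Binet_Fibonacci Binet_Lucas)
  also have "(golden powi a + golden_conj powi a) * (golden powi b - golden_conj powi b)
      = golden powi (a + b) - golden_conj powi (a + b)
        - golden powi a * golden_conj powi b + golden_conj powi a * golden powi b"
    by (simp add: power_int_add algebra_simps)
  also have "\<dots> = (golden powi (a + b) - golden_conj powi (a + b))
      - (- 1) powi b * (golden powi (a - b) - golden_conj powi (a - b))"
    unfolding golden_mixed_product by (simp add: algebra_simps)
  finally show ?thesis
    by (simp only: Binet_Fibonacci[of "a + b"] Binet_Fibonacci[of "a - b"] diff_divide_distrib
        times_divide_eq_right right_diff_distrib)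
qed

lemma Lucas_mult_Lucas:
  "real_of_int (Lucas a) * real_of_int (Lucas b)
    = real_of_int (Lucas (a + b)) + (- 1) powi b * real_of_int (Lucas (a - b))"
proof -
  have "real_of_int (Lucas a) * real_of_int (Lucas b)
      = golden powi (a + b) + golden_conj powi (a + b)
        + golden powi a * golden_conj powi b + golden_conj powi a * golden powi b"
    by (simp add: Binet_Lucas power_int_add algebra_simps)
  then show ?thesis
    unfolding golden_mixed_product Binet_Lucas by (simp add: algebra_simps)
qed

section \<open>Binomial sums of Lucas and Fibonacci numbers\<close>

text \<open>By the Binet formula this is the sum of \<open>sum_even_binomial_golden\<close> over
  both roots.\<close>

lemma sum_even_binomial_Lucas:
  assumes "n > 0"
  shows "(\<Sum>k = 0..n div 2. real (n choose (2 * k)) * real_of_int (Lucas (6 * int k + t)))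
    = 2 ^ (n - 1) * (real_of_int (Lucas (2 * int n + t)) + (- 1) ^ n * real_of_int (Lucas (int n + t)))"
  unfolding Binet_Lucas distrib_left sum.distrib
    sum_even_binomial_golden[OF golden_square(1) assms] sum_even_binomial_golden[OF golden_square(2) assms]
  by simp

lemma sum_even_binomial_Fibonacci:
  assumes "n > 0"
  shows "(\<Sum>k = 0..n div 2. real (n choose (2 * k)) * real_of_int (Fibonacci (6 * int k + t)))
    = 2 ^ (n - 1) * (real_of_int (Fibonacci (2 * int n + t)) + (- 1) ^ n * real_of_int (Fibonacci (int n + t)))"
proof -
  have "(\<Sum>k = 0..n div 2. real (n choose (2 * k)) * real_of_int (Fibonacci (6 * int k + t)))
      = ((\<Sum>k = 0..n div 2. real (n choose (2 * k)) * golden powi (6 * int k + t))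
          - (\<Sum>k = 0..n div 2. real (n choose (2 * k)) * golden_conj powi (6 * int k + t))) / sqrt 5"
    by (simp only: Binet_Fibonacci times_divide_eq_right right_diff_distrib diff_divide_distrib
        sum_subtractf sum_divide_distrib)
  also have "\<dots> = 2 ^ (n - 1) * ((golden powi (2 * int n + t) - golden_conj powi (2 * int n + t)) / sqrt 5
        + (- 1) ^ n * ((golden powi (int n + t) - golden_conj powi (int n + t)) / sqrt 5))"
    unfolding sum_even_binomial_golden[OF golden_square(1) assms]
      sum_even_binomial_golden[OF golden_square(2) assms] times_divide_eq_right add_divide_distrib[symmetric]
    \<comment> \<open>Both sides are now quotients by \<open>sqrt 5\<close>, so comparing numerators
      suffices.\<close>
    by (rule arg_cong[where f = "\<lambda>x. x / sqrt 5"]) (simp add: right_diff_distrib distrib_left)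
  finally show ?thesis
    by (simp only: Binet_Fibonacci)
qed

text \<open>Common pattern of the three identities: \<open>p\<close> is the product,
  \<open>f\<close> is \<open>Lucas\<close> or \<open>Fibonacci\<close>, \<open>c\<close> is the sign
  of the cross term, and \<open>d\<close> is its value at the fixed index difference.\<close>

lemma sum_even_binomial_split:
  fixes f :: "int \<Rightarrow> real"
  assumes split: "\<And>k. p k = f (6 * int k + t) + c * (- 1) powi (3 * int k + s) * d"
    and f: "(\<Sum>k = 0..n div 2. real (n choose (2 * k)) * f (6 * int k + t)) = A"
  shows "(\<Sum>k = 0..n div 2. real (n choose (2 * k)) * p k)
    = A + c * ((- 1) powi s * sqrt (2 ^ n) * cos (real n * pi / 4) * d)"
proof -
  \<comment> \<open>As 3 is odd, the sign alternates with \<open>k\<close>, which brings in the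
    alternating binomial sum.\<close>
  have sgn: "(- 1) powi (3 * int k + s) = (- 1) ^ k * ((- 1) powi s :: real)" for k
    by (simp add: power_int_add power_int_mult)
  have "(\<Sum>k = 0..n div 2. real (n choose (2 * k)) * p k)
      = (\<Sum>k = 0..n div 2. real (n choose (2 * k)) * f (6 * int k + t)
          + real (n choose (2 * k)) * (- 1) ^ k * (c * (- 1) powi s * d))"
    unfolding split sgn by (simp add: algebra_simps)
  also have "\<dots> = A + sqrt (2 ^ n) * cos (real n * pi / 4) * (c * (- 1) powi s * d)"
    by (simp only: sum.distrib f sum_distrib_right[symmetric] sum_even_binomial_alternating)
  finally show ?thesis
    by (simp add: mult_ac)
qed

theorem theorem28:
  fixes n :: nat and r s :: int
  assumes "n > 0"
  shows
    "(5 * (\<Sum>k = 0..n div 2. real (n choose (2 * k)) *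
          real_of_int (Fibonacci (3 * int k + r)) * real_of_int (Fibonacci (3 * int k + s)))
      = 2 ^ (n - 1) * (real_of_int (Lucas (2 * int n + r + s))
                        + (- 1) ^ n * real_of_int (Lucas (int n + r + s)))
        - (- 1) powi s * sqrt (2 ^ n) * cos (real n * pi / 4) * real_of_int (Lucas (r - s)))
     \<and> ((\<Sum>k = 0..n div 2. real (n choose (2 * k)) *
          real_of_int (Lucas (3 * int k + r)) * real_of_int (Fibonacci (3 * int k + s)))
      = 2 ^ (n - 1) * (real_of_int (Fibonacci (2 * int n + r + s))
                        + (- 1) ^ n * real_of_int (Fibonacci (int n + r + s)))
        - (- 1) powi s * sqrt (2 ^ n) * cos (real n * pi / 4) * real_of_int (Fibonacci (r - s)))
     \<and> ((\<Sum>k = 0..n div 2. real (n choose (2 * k)) *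
          real_of_int (Lucas (3 * int k + r)) * real_of_int (Lucas (3 * int k + s)))
      = 2 ^ (n - 1) * (real_of_int (Lucas (2 * int n + r + s))
                        + (- 1) ^ n * real_of_int (Lucas (int n + r + s)))
        + (- 1) powi s * sqrt (2 ^ n) * cos (real n * pi / 4) * real_of_int (Lucas (r - s)))"
proof -
  have index: "3 * int k + r + (3 * int k + s) = 6 * int k + (r + s)"
      "3 * int k + r - (3 * int k + s) = r - s" for k
    by simp_all
  \<comment> \<open>The explicit factors \<open>(- 1) *\<close> here and in \<open>LF\<close>, and
    \<open>1 *\<close> in \<open>LL\<close>, fill the slot \<open>c\<close> of
    \<open>sum_even_binomial_split\<close>.\<close>
  have FF: "5 * (real_of_int (Fibonacci (3 * int k + r)) * real_of_int (Fibonacci (3 * int k + s)))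
      = real_of_int (Lucas (6 * int k + (r + s)))
        + (- 1) * (- 1) powi (3 * int k + s) * real_of_int (Lucas (r - s))" for k
    unfolding Fibonacci_mult_Fibonacci index by simp
  have LF: "real_of_int (Lucas (3 * int k + r)) * real_of_int (Fibonacci (3 * int k + s))
      = real_of_int (Fibonacci (6 * int k + (r + s)))
        + (- 1) * (- 1) powi (3 * int k + s) * real_of_int (Fibonacci (r - s))" for k
    unfolding Lucas_mult_Fibonacci index by simp
  have LL: "real_of_int (Lucas (3 * int k + r)) * real_of_int (Lucas (3 * int k + s))
      = real_of_int (Lucas (6 * int k + (r + s)))
        + 1 * (- 1) powi (3 * int k + s) * real_of_int (Lucas (r - s))" for k
    unfolding Lucas_mult_Lucas index by simp
  have five: "5 * (\<Sum>k = 0..n div 2. real (n choose (2 * k)) * g k)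
      = (\<Sum>k = 0..n div 2. real (n choose (2 * k)) * (5 * g k))" for g
    by (simp only: sum_distrib_left mult.left_commute)
  show ?thesis
    \<comment> \<open>Reassociation groups each product into a single \<open>p k\<close> and each
      index as a multiple of \<open>int n\<close> plus \<open>t = r + s\<close>.\<close>
    unfolding mult.assoc[of "real (n choose m)" for m] five add.assoc[of _ r s]
      sum_even_binomial_split[where f = "\<lambda>j. real_of_int (Lucas j)", OF FF sum_even_binomial_Lucas[OF assms]]
      sum_even_binomial_split[where f = "\<lambda>j. real_of_int (Fibonacci j)", OF LF sum_even_binomial_Fibonacci[OF assms]]
      sum_even_binomial_split[where f = "\<lambda>j. real_of_int (Lucas j)", OF LL sum_even_binomial_Lucas[OF assms]]
    by simp
qed

end
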